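(* Let $1\le m\le n-1$ be integers. A Radon measure $\mu$ on $\mathbb{R}^n$ charges some $m$-dimensional Lipschitz graph, i.e. $\mu(\Gamma)>0$ for some $m$-dimensional Lipschitz graph $\Gamma$, if and only if there exists $E\subseteq\mathbb{R}^n$ with $\mu(E)>0$ such that for each $x\in E$ there is a bad cone $X=X(V_x,\alpha_x)$ (with $V_x\in G(n,m)$ and $\alpha_x\in(0,\infty)$) with $G_{\mu,X}(x)<\infty$.
   Context: Fix integers $1\le m\le n-1$. $G(n,m)$ is the set of $m$-dimensional linear subspaces of $\mathbb{R}^n$ and $V^\perp$ is the orthogonal complement of $V$. $B(x,r)$ and $U(x,r)$ denote closed and open Euclidean balls. A Radon measure on $\mathbb{R}^n$ is a Borel regular outer measure that is finite on compact sets (so $\mu(E)$ is defined for every $E\subseteq\mathbb{R}^n$). Lipschitz graphs. An $m$-dimensional Lipschitz graph is a set $\mathrm{Graph}(f)=\{(x,f(x)):x\in V\}=\{x+f(x):x\in V\}\subseteq V\times V^\perp=\mathbb{R}^n$, where $V\in G(n,m)$ and $f:V\to V^\perp$ is a Lipschitz function. Bad cones. A bad cone is a set $X=X(V,\alpha)=\{x\in\mathbb{R}^n:\operatorname{dist}(x,V)>\alpha\operatorname{dist}(x,V^\perp)\}$ with $V\in G(n,m)$ and $\alpha\in(0,\infty)$. Write $X_x=x+X$ and $X_Q=\bigcup_{x\in Q}X_x$ for nonempty $Q\subseteq\mathbb{R}^n$. Dyadic cubes. A dyadic cube is a half-open cube $Q=\prod_{i=1}^n[j_i2^{-k},(j_i+1)2^{-k})$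 with $k,j_1,\dots,j_n\in\mathbb{Z}$; $\operatorname{side}Q=2^{-k}$ and $x_Q$ is the center of $Q$. Conical defect. For a dyadic cube $Q$ and bad cone $X=X(V,\alpha)$, put $r_{Q,X}=81\sqrt{n}\max(\alpha,1/\alpha)\operatorname{side}Q$ and $A_{Q,X}=X_Q\cap B(x_Q,r_{Q,X})\setminus U(x_Q,r_{Q,X}/3)$. Let $\Delta^*_{Q,X}$ be the set of all dyadic cubes $R$ with $\operatorname{side}R=\operatorname{side}Q$ and $R\cap A_{Q,X}\ne\emptyset$. For a Radon measure $\mu$, set $\mathrm{Defect}(\mu,Q,X)=\sum_{R\in\Delta^*_{Q,X}}\mu(R)/\mu(Q)$ if $\mu(Q)>0$, and $\mathrm{Defect}(\mu,Q,X)=0$ if $\mu(Q)=0$. Conical Dini function. $G_{\mu,X}:\mathbb{R}^n\to[0,\infty]$ is $G_{\mu,X}(x)=\sum_{\operatorname{side}Q\le1}\mathrm{Defect}(\mu,Q,X)\,\chi_Q(x)$, the sum over all dyadic cubes $Q$ of side length at most $1$. *)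

theory Defs
  imports "HOL-Analysis.Analysis"
begin

text \<open>Measures in the sense of geometric measure theory: Borel regular outer measures, defined on
  all subsets of the space.  Over the full power set, \<^const>\<open>outer_measure_space\<close> is the
  usual notion (null on the empty set, monotone, countably subadditive; subadditivity for disjoint
  families suffices because of monotonicity), and \<^const>\<open>lambda_system\<close> is the class of
  Caratheodory measurable sets.\<close>

definition radon_measure :: "((real ^ 'n::finite) set \<Rightarrow> ennreal) \<Rightarrow> bool" where
  "radon_measure \<mu> \<longleftrightarrow>
     outer_measure_space UNIV \<mu> \<and>
     sets borel \<subseteq> lambda_system UNIV UNIV \<mu> \<and>
     (\<forall>A. \<exists>B\<in>sets borel. A \<subseteq> B \<and> \<mu> B = \<mu> A) \<and>
     (\<forall>K. compact K \<longrightarrow> \<mu> K < \<infinity>)"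

definition grassmannian :: "nat \<Rightarrow> (real ^ 'n::finite) set set" where
  "grassmannian m = {V. subspace V \<and> dim V = m}"

definition lipschitz_graph :: "nat \<Rightarrow> (real ^ 'n::finite) set \<Rightarrow> bool" where
  "lipschitz_graph m \<Gamma> \<longleftrightarrow>
     (\<exists>V\<in>grassmannian m. \<exists>f. f ` V \<subseteq> orthogonal_comp V \<and> (\<exists>L. L-lipschitz_on V f) \<and>
        \<Gamma> = {x + f x |x. x \<in> V})"

definition bad_cone :: "(real ^ 'n::finite) set \<Rightarrow> real \<Rightarrow> (real ^ 'n) set" where
  "bad_cone V \<alpha> = {x. infdist x V > \<alpha> * infdist x (orthogonal_comp V)}"

definition bad_cone_over ::
    "(real ^ 'n::finite) set \<Rightarrow> real \<Rightarrow> (real ^ 'n) set \<Rightarrow> (real ^ 'n) set" where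
  "bad_cone_over V \<alpha> Q = (\<Union>x\<in>Q. (+) x ` bad_cone V \<alpha>)"

text \<open>A dyadic cube is represented by its pair of parameters \<open>(k, j)\<close>; by injectivity of
  \<open>cube_set\<close>, proved below, ranging over such pairs is the same as ranging over
  the cubes as point sets.\<close>

type_synonym 'n dyadic_cube = "int \<times> (int ^ 'n)"

fun side :: "'n::finite dyadic_cube \<Rightarrow> real" where
  "side (k, j) = 2 powi (- k)"

fun cube_set :: "'n::finite dyadic_cube \<Rightarrow> (real ^ 'n) set" where
  "cube_set (k, j) =
     {x. \<forall>i. x $ i \<in> {of_int (j $ i) * 2 powi (- k) ..< (of_int (j $ i) + 1) * 2 powi (- k)}}"

fun cube_center :: "'n::finite dyadic_cube \<Rightarrow> real ^ 'n" where
  "cube_center (k, j) = (\<chi> i. (of_int (j $ i) + 1 / 2) * 2 powi (- k))"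

lemma inj_cube_set: "inj (cube_set :: 'n::finite dyadic_cube \<Rightarrow> _)"
proof (rule injI, clarify)
  fix k k' :: int and j j' :: "int ^ 'n"
  assume eq: "cube_set (k, j) = cube_set (k', j')"
  define s s' where "s = (2::real) powi (- k)" and "s' = (2::real) powi (- k')"
  have pos: "s > 0" "s' > 0" by (auto simp: s_def s'_def)
  define a a' where "a = (\<chi> i. of_int (j $ i) * s)" and "a' = (\<chi> i. of_int (j' $ i) * s')"
  have mem: "x \<in> cube_set (k, j) \<longleftrightarrow> (\<forall>i. a $ i \<le> x $ i \<and> x $ i < a $ i + s)"
    and mem': "x \<in> cube_set (k', j') \<longleftrightarrow> (\<forall>i. a' $ i \<le> x $ i \<and> x $ i < a' $ i + s')" for x
    by (auto simp: a_def a'_def s_def s'_def algebra_simps)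
  have iff: "(\<forall>i. a $ i \<le> x $ i \<and> x $ i < a $ i + s) \<longleftrightarrow>
             (\<forall>i. a' $ i \<le> x $ i \<and> x $ i < a' $ i + s')" for x
    using eq mem mem' by metis
  have aa: "a = a'"
    using iff[of a] iff[of a'] pos by (auto simp: vec_eq_iff intro!: antisym)
  have "\<not> s < s'"
    using iff[of "\<chi> i. a $ i + s"] pos aa by auto
  moreover have "\<not> s' < s"
    using iff[of "\<chi> i. a $ i + s'"] pos aa by auto
  ultimately have ss: "s = s'" by simp
  then have k: "k = k'"
    using power_int_strict_increasing[of "- k" "- k'" "2::real"]
      power_int_strict_increasing[of "- k'" "- k" "2::real"]
    by (cases k k' rule: linorder_cases) (simp_all add: s_def s'_def)
  have "j $ i = j' $ i" for i
    using arg_cong[OF aa, of "\<lambda>v. v $ i"] pos ss by (simp add: a_def a'_def)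
  with k show "k = k' \<and> j = j'" by (simp add: vec_eq_iff)
qed

definition cone_radius :: "real \<Rightarrow> 'n::finite dyadic_cube \<Rightarrow> real" where
  "cone_radius \<alpha> Q = 81 * sqrt (real CARD('n)) * max \<alpha> (1 / \<alpha>) * side Q"

definition conical_annulus ::
    "(real ^ 'n::finite) set \<Rightarrow> real \<Rightarrow> 'n dyadic_cube \<Rightarrow> (real ^ 'n) set" where
  "conical_annulus V \<alpha> Q =
     bad_cone_over V \<alpha> (cube_set Q) \<inter> cball (cube_center Q) (cone_radius \<alpha> Q)
       - ball (cube_center Q) (cone_radius \<alpha> Q / 3)"

definition nearby_cubes ::
    "(real ^ 'n::finite) set \<Rightarrow> real \<Rightarrow> 'n dyadic_cube \<Rightarrow> 'n dyadic_cube set" where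
  "nearby_cubes V \<alpha> Q = {R. side R = side Q \<and> cube_set R \<inter> conical_annulus V \<alpha> Q \<noteq> {}}"

definition defect ::
    "((real ^ 'n::finite) set \<Rightarrow> ennreal) \<Rightarrow> (real ^ 'n) set \<Rightarrow> real \<Rightarrow> 'n dyadic_cube \<Rightarrow> ennreal" where
  "defect \<mu> V \<alpha> Q =
     (if \<mu> (cube_set Q) > 0
      then (\<Sum>\<^sub>\<infinity>R\<in>nearby_cubes V \<alpha> Q. \<mu> (cube_set R) / \<mu> (cube_set Q))
      else 0)"

definition conical_dini ::
    "((real ^ 'n::finite) set \<Rightarrow> ennreal) \<Rightarrow> (real ^ 'n) set \<Rightarrow> real \<Rightarrow> real ^ 'n \<Rightarrow> ennreal" where
  "conical_dini \<mu> V \<alpha> x =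
     (\<Sum>\<^sub>\<infinity>Q\<in>{Q. side Q \<le> 1}. defect \<mu> V \<alpha> Q * indicator (cube_set Q) x)"

end

theory Submission
  imports Defs
begin

text \<open>The two conditions are linked by one integral.  For a bounded set \<open>E\<close>, let \<open>\<Phi>\<close> be the Dini
  series restricted to the cubes that meet \<open>E\<close> (\<open>dini_along\<close>).  Integrating it, the mass of each cube
  cancels against the denominator of its defect.  So the integral of \<open>\<Phi>\<close> is the sum of the
  masses \<open>\<mu>(R)\<close> over all pairs of a non-null cube \<open>Q\<close> meeting \<open>E\<close> and a cube \<open>R\<close> near \<open>Q\<close>
  (\<open>integral_dini_along\<close>, \<open>shape_defect_times_mass\<close>).

  Suppose first that a graph \<open>\<Gamma>\<close> of a function with Lipschitz constant \<open>L\<close> is charged, and let \<open>E\<close> be a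
  bounded part of it with positive measure.  If the opening of the bad cone is large compared with
  \<open>L\<close>, a cube \<open>R\<close> near a cube that meets \<open>\<Gamma>\<close> lies at a distance from \<open>\<Gamma>\<close> that is comparable to
  its side (\<open>nearby_cube_dist_graph\<close>).  A given point is in such a position for
  boundedly many scales only.  Hence the sum of the masses is finite, \<open>\<Phi>\<close> is finite almost
  everywhere, and so is the Dini function almost everywhere on \<open>E\<close>.

  Suppose conversely that the Dini function is finite on a set of positive measure.  There are only
  countably many Dini functions, because the pattern of the cubes near \<open>Q\<close> is a
  rescaled copy of a finite pattern of integer vectors (\<open>cone_shape\<close>).  So one cone may be used for all
  points, and the Dini function may be assumed to be bounded by some \<open>N\<close> on a bounded
  set \<open>E\<close> of positive measure.  Then \<open>\<Phi> \<le> N\<close> everywhere (\<open>dini_along_le\<close>), the sum of the masses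
  is finite, and the nearby cubes of all sufficiently small cubes have in total less mass than \<open>E\<close>.
  Remove them from \<open>E\<close>.  If \<open>y\<close> were in the bad cone at \<open>x\<close> for two close points \<open>x\<close> and \<open>y\<close> of the
  remaining set, then \<open>y\<close> would be in the annulus of a small cube containing \<open>x\<close>
  (\<open>bad_cone_mem_conical_annulus\<close>), and would have been removed.  So a small piece of the remaining
  set avoids its bad cones and lies in a Lipschitz graph
  (\<open>cone_condition_subset_lipschitz_graph\<close>).\<close>

section \<open>Distances to a subspace and its orthogonal complement\<close>

text \<open>The two distances in the definition of a bad cone are the lengths of the components of a
  vector in an orthogonal decomposition.  As functions of the vector they are seminorms bounded by
  the norm, which is what the estimates below use instead of projections.\<close>

lemma infdist_subspace_add:
  fixes V :: "'a::euclidean_space set"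
  assumes "subspace V" "v \<in> V" "w \<in> orthogonal_comp V"
  shows "infdist (v + w) V = norm w"
proof (rule antisym)
  show "infdist (v + w) V \<le> norm w"
    using infdist_le[OF assms(2), of "v + w"] by (simp add: dist_norm)
  have "norm w \<le> dist (v + w) a" if "a \<in> V" for a
  proof -
    have "v - a \<in> V"
      using assms that by (simp add: subspace_diff)
    then have "orthogonal (v - a) w"
      using assms(3) by (auto simp: orthogonal_comp_def)
    then have "norm ((v - a) + w) ^ 2 = norm (v - a) ^ 2 + norm w ^ 2"
      by (rule norm_add_Pythagorean)
    then have "norm w ^ 2 \<le> norm ((v - a) + w) ^ 2" by simp
    then have "norm w \<le> norm ((v - a) + w)" by (rule power2_le_imp_le) simp
    then show ?thesis by (simp add: dist_norm algebra_simps)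
  qed
  then show "norm w \<le> infdist (v + w) V"
    using assms(2) by (subst infdist_notempty) (auto intro!: cINF_greatest)
qed

lemma infdist_orthogonal_comp_add:
  fixes V :: "'a::euclidean_space set"
  assumes "subspace V" "v \<in> V" "w \<in> orthogonal_comp V"
  shows "infdist (v + w) (orthogonal_comp V) = norm v"
  using infdist_subspace_add[OF subspace_orthogonal_comp assms(3), of v] assms(2)
    orthogonal_comp_subset[of V] by (auto simp: add.commute)

lemma orthogonal_decomposition:
  fixes V :: "'a::euclidean_space set"
  assumes "subspace V"
  obtains v w where "v \<in> V" "w \<in> orthogonal_comp V" "x = v + w"
    "infdist x V = norm w" "infdist x (orthogonal_comp V) = norm v"
proof -
  obtain v w where vw: "v \<in> span V" "\<And>u. u \<in> span V \<Longrightarrow> orthogonal w u" "x = v + w"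
    using orthogonal_subspace_decomp_exists[of V x] by metis
  then have "v \<in> V" "w \<in> orthogonal_comp V"
    using span_eq_iff[THEN iffD2, OF assms]
    by (auto simp: orthogonal_comp_def orthogonal_commute)
  then show thesis
    using that vw(3) infdist_subspace_add[OF assms] infdist_orthogonal_comp_add[OF assms] by metis
qed

lemma infdist_subspace_add_le:
  fixes V :: "'a::euclidean_space set"
  assumes "subspace V"
  shows "infdist (x + y) V \<le> infdist x V + infdist y V"
proof -
  obtain v w where x: "v \<in> V" "w \<in> orthogonal_comp V" "x = v + w" "infdist x V = norm w"
    using orthogonal_decomposition[OF assms] by metis
  obtain v' w' where y: "v' \<in> V" "w' \<in> orthogonal_comp V" "y = v' + w'" "infdist y V = norm w'"
    using orthogonal_decomposition[OF assms] by metis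
  have "infdist ((v + v') + (w + w')) V = norm (w + w')"
    using assms x y by (intro infdist_subspace_add) (auto simp: subspace_add subspace_orthogonal_comp)
  then show ?thesis
    using x y norm_triangle_ineq[of w w'] by (simp add: algebra_simps)
qed

lemma infdist_subspace_scaleR:
  fixes V :: "'a::euclidean_space set"
  assumes "subspace V"
  shows "infdist (c *\<^sub>R x) V = \<bar>c\<bar> * infdist x V"
proof -
  obtain v w where x: "v \<in> V" "w \<in> orthogonal_comp V" "x = v + w" "infdist x V = norm w"
    using orthogonal_decomposition[OF assms] by metis
  have "infdist (c *\<^sub>R v + c *\<^sub>R w) V = norm (c *\<^sub>R w)"
    using assms x by (intro infdist_subspace_add) (auto simp: subspace_scale subspace_orthogonal_comp)
  then show ?thesis
    using x by (simp add: algebra_simps)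
qed

lemma infdist_subspace_le_norm:
  fixes V :: "'a::euclidean_space set"
  assumes "subspace V"
  shows "infdist x V \<le> norm x"
  using infdist_le[OF subspace_0[OF assms], of x] by simp

lemma norm_le_infdist_sum:
  fixes V :: "'a::euclidean_space set"
  assumes "subspace V"
  shows "norm x \<le> infdist x V + infdist x (orthogonal_comp V)"
  using orthogonal_decomposition[OF assms, of x] norm_triangle_ineq
  by (metis add.commute)


section \<open>Lipschitz graphs and the cone condition\<close>

text \<open>McShane's extension: \<open>x \<mapsto> f a + C |x - a|\<close> is the largest \<open>C\<close>-Lipschitz function with
  the value \<open>f a\<close> at \<open>a\<close>, and the infimum over \<open>a\<close> of these functions is again
  \<open>C\<close>-Lipschitz.\<close>

lemma lipschitz_extension_real:
  fixes f :: "'a::metric_space \<Rightarrow> real"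
  assumes f: "C-lipschitz_on S f" and "S \<noteq> {}"
  obtains g where "C-lipschitz_on UNIV g" "\<And>x. x \<in> S \<Longrightarrow> g x = f x"
proof
  define g where "g x = (INF a\<in>S. f a + C * dist x a)" for x
  have C: "C \<ge> 0"
    using f by (rule lipschitz_on_nonneg)
  obtain b where b: "b \<in> S"
    using assms(2) by auto
  have low: "f c - C * dist x c \<le> f a + C * dist x a" if "a \<in> S" "c \<in> S" for x a c
  proof -
    have "f c - f a \<le> C * dist c a"
      using lipschitz_onD[OF f that(2,1)] by (simp add: dist_real_def)
    also have "\<dots> \<le> C * (dist x c + dist x a)"
      using C by (intro mult_left_mono) (auto simp: dist_triangle3)
    finally show ?thesis by (simp add: algebra_simps)
  qed
  have bdd: "bdd_below ((\<lambda>a. f a + C * dist x a) ` S)" for x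
    using low[OF _ b] by (intro bdd_belowI2) auto
  have le: "g x \<le> g y + C * dist x y" for x y
  proof -
    have "g x - C * dist x y \<le> f a + C * dist y a" if "a \<in> S" for a
    proof -
      have "g x \<le> f a + C * dist x a"
        unfolding g_def using bdd that by (rule cINF_lower)
      also have "\<dots> \<le> f a + C * (dist x y + dist y a)"
        using C by (intro add_left_mono mult_left_mono dist_triangle) auto
      finally show ?thesis by (simp add: algebra_simps)
    qed
    then have "g x - C * dist x y \<le> g y"
      unfolding g_def[of y] using assms(2) by (intro cINF_greatest) auto
    then show ?thesis by simp
  qed
  show "C-lipschitz_on UNIV g"
  proof (rule lipschitz_onI)
    show "dist (g x) (g y) \<le> C * dist x y" for x y
      using le[of x y] le[of y x] by (simp add: dist_real_def abs_le_iff dist_commute)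
  qed (rule C)
  show "g x = f x" if x: "x \<in> S" for x
  proof (rule antisym)
    show "g x \<le> f x"
      using cINF_lower[OF bdd x, of x] by (simp add: g_def)
    show "f x \<le> g x"
      unfolding g_def using low[OF _ x, of _ x] assms(2) by (intro cINF_greatest) auto
  qed
qed

text \<open>The coordinates are extended separately, at the price of the dimension in the constant;
  only the existence of some Lipschitz constant matters for graphs.\<close>

lemma lipschitz_extension_vec:
  fixes f :: "'a::metric_space \<Rightarrow> real ^ 'n::finite"
  assumes f: "C-lipschitz_on S f" and "S \<noteq> {}"
  obtains g where "(real CARD('n) * C)-lipschitz_on UNIV g" "\<And>x. x \<in> S \<Longrightarrow> g x = f x"
proof -
  have C: "C \<ge> 0"
    using f by (rule lipschitz_on_nonneg)
  have "\<exists>h. C-lipschitz_on UNIV h \<and> (\<forall>x\<in>S. h x = f x $ i)" for i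
  proof -
    have "C-lipschitz_on S (\<lambda>x. f x $ i)"
      using C lipschitz_onD[OF f] by (intro lipschitz_onI) (auto intro: order_trans[OF dist_vec_nth_le])
    then obtain h where "C-lipschitz_on UNIV h" "\<And>x. x \<in> S \<Longrightarrow> h x = f x $ i"
      using lipschitz_extension_real[OF _ assms(2)] by blast
    then show ?thesis by blast
  qed
  then obtain h where h: "\<And>i. C-lipschitz_on UNIV (h i)" "\<And>i x. x \<in> S \<Longrightarrow> h i x = f x $ i"
    by metis
  show thesis
  proof
    show "(real CARD('n) * C)-lipschitz_on UNIV (\<lambda>x. \<chi> i. h i x)"
    proof (rule lipschitz_onI)
      fix x y
      have "dist (\<chi> i. h i x) (\<chi> i. h i y) \<le> (\<Sum>i\<in>UNIV. \<bar>((\<chi> i. h i x) - (\<chi> i. h i y)) $ i\<bar>)"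
        unfolding dist_norm by (rule norm_le_l1_cart)
      also have "\<dots> \<le> (\<Sum>i\<in>(UNIV :: 'n set). C * dist x y)"
        using lipschitz_onD[OF h(1)] by (intro sum_mono) (auto simp: dist_real_def)
      finally show "dist (\<chi> i. h i x) (\<chi> i. h i y) \<le> real CARD('n) * C * dist x y" by simp
    qed (use C in simp)
    show "(\<chi> i. h i x) = f x" if "x \<in> S" for x
      using h(2)[OF that] by (simp add: vec_eq_iff)
  qed
qed

definition cone_condition :: "(real ^ 'n::finite) set \<Rightarrow> real \<Rightarrow> (real ^ 'n) set \<Rightarrow> bool" where
  "cone_condition V \<alpha> A \<longleftrightarrow> (\<forall>x\<in>A. \<forall>y\<in>A. y - x \<notin> bad_cone V \<alpha>)"

lemma lipschitz_graph_cone_condition: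
  assumes "lipschitz_graph m \<Gamma>"
  obtains V L where "V \<in> grassmannian m" "L \<ge> 0" "cone_condition V L \<Gamma>"
proof -
  obtain V f L where V: "V \<in> grassmannian m" and f: "f ` V \<subseteq> orthogonal_comp V"
      and L: "L-lipschitz_on V f" and \<Gamma>: "\<Gamma> = {x + f x |x. x \<in> V}"
    using assms by (auto simp: lipschitz_graph_def)
  have sub: "subspace V"
    using V by (simp add: grassmannian_def)
  have "(y + f y) - (x + f x) \<notin> bad_cone V L" if "x \<in> V" "y \<in> V" for x y
  proof -
    have perp: "f y - f x \<in> orthogonal_comp V"
      using f that by (intro subspace_diff[OF subspace_orthogonal_comp]) auto
    have "infdist ((y - x) + (f y - f x)) V = norm (f y - f x)"
      using sub that perp by (simp add: infdist_subspace_add subspace_diff)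
    moreover have "infdist ((y - x) + (f y - f x)) (orthogonal_comp V) = norm (y - x)"
      using sub that perp by (simp add: infdist_orthogonal_comp_add subspace_diff)
    moreover have "norm (f y - f x) \<le> L * norm (y - x)"
      using lipschitz_onD[OF L that(2,1)] by (simp add: dist_norm)
    ultimately show ?thesis
      by (simp add: bad_cone_def algebra_simps)
  qed
  then have "cone_condition V L \<Gamma>"
    unfolding cone_condition_def \<Gamma> by blast
  then show thesis
    by (rule that[OF V lipschitz_on_nonneg[OF L]])
qed

text \<open>The cone condition says exactly that the orthogonal projection to \<open>V\<close> is injective on
  \<open>A\<close> and that the complementary component is an \<open>\<alpha>\<close>-Lipschitz function of it.  An
  extension of this function to \<open>V\<close> may leave the orthogonal complement, so it is
  composed with the projection to the complement.\<close>

lemma cone_condition_subset_lipschitz_graph: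
  assumes V: "V \<in> grassmannian m" and \<alpha>: "\<alpha> \<ge> 0" and A: "cone_condition V \<alpha> A" "A \<noteq> {}"
  obtains \<Gamma> where "lipschitz_graph m \<Gamma>" "A \<subseteq> \<Gamma>"
proof -
  let ?W = "orthogonal_comp V"
  have sub: "subspace V" "subspace ?W"
    using V by (auto simp: grassmannian_def subspace_orthogonal_comp)
  have "\<forall>x. \<exists>p q. p \<in> V \<and> q \<in> ?W \<and> p + q = x"
    using orthogonal_decomposition[OF sub(1)] by metis
  then obtain p q where pq: "\<And>x. p x \<in> V" "\<And>x. q x \<in> ?W" "\<And>x. p x + q x = x"
    by metis
  have diff: "infdist (y - x) V = norm (q y - q x)" "infdist (y - x) ?W = norm (p y - p x)" for x y
  proof -
    have eq: "y - x = (p y - p x) + (q y - q x)"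
      using pq(3)[of x] pq(3)[of y] by (metis add_diff_add)
    show "infdist (y - x) V = norm (q y - q x)" "infdist (y - x) ?W = norm (p y - p x)"
      unfolding eq using sub pq
      by (auto intro!: infdist_subspace_add infdist_orthogonal_comp_add subspace_diff)
  qed
  have q_le: "norm (q y - q x) \<le> norm (y - x)" for x y
    using infdist_subspace_le_norm[OF sub(1), of "y - x"] by (simp add: diff)
  have cone: "norm (q y - q x) \<le> \<alpha> * norm (p y - p x)" if "x \<in> A" "y \<in> A" for x y
    using A(1) that by (auto simp: cone_condition_def bad_cone_def diff not_less)
  define f where "f v = q (SOME x. x \<in> A \<and> p x = v)" for v
  have f: "f (p x) = q x" if "x \<in> A" for x
  proof -
    have "(SOME x'. x' \<in> A \<and> p x' = p x) \<in> A \<and> p (SOME x'. x' \<in> A \<and> p x' = p x) = p x"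
      by (rule someI[of _ x]) (use that in simp)
    with cone[OF that this[THEN conjunct1]] show ?thesis by (simp add: f_def)
  qed
  have "\<alpha>-lipschitz_on (p ` A) f"
    using cone f \<alpha> by (auto intro!: lipschitz_onI simp: dist_norm)
  then obtain g where g: "(real CARD('a) * \<alpha>)-lipschitz_on UNIV g"
      "\<And>v. v \<in> p ` A \<Longrightarrow> g v = f v"
    using lipschitz_extension_vec A(2) by (metis image_is_empty)
  have q_id: "q w = w" if "w \<in> ?W" for w
  proof -
    have "p w = w - q w"
      using pq(3)[of w] by (simp add: eq_diff_eq)
    then have "p w \<in> ?W"
      using that pq(2) sub(2) by (simp add: subspace_diff)
    then have "p w \<bullet> p w = 0"
      using pq(1)[of w] by (simp add: orthogonal_comp_def orthogonal_def)
    then have "p w = 0" by simp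
    then show ?thesis
      using pq(3)[of w] by simp
  qed
  have "lipschitz_graph m {v + q (g v) |v. v \<in> V}"
    unfolding lipschitz_graph_def
  proof (intro bexI[OF _ V] exI[of _ "\<lambda>v. q (g v)"] conjI refl)
    show "(\<lambda>v. q (g v)) ` V \<subseteq> ?W"
      using pq(2) by auto
    have "(real CARD('a) * \<alpha>)-lipschitz_on V (\<lambda>v. q (g v))"
      using \<alpha> lipschitz_onD[OF g(1)]
      by (intro lipschitz_onI) (auto simp: dist_norm intro: order_trans[OF q_le])
    then show "\<exists>L. L-lipschitz_on V (\<lambda>v. q (g v))" by blast
  qed
  moreover have "A \<subseteq> {v + q (g v) |v. v \<in> V}"
  proof
    fix x assume "x \<in> A"
    then have "q (g (p x)) = q x"
      using g(2) f q_id pq(2) by simp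
    then show "x \<in> {v + q (g v) |v. v \<in> V}"
      using pq(1)[of x] pq(3)[of x] by (intro CollectI exI[of _ "p x"]) simp
  qed
  ultimately show thesis by (rule that)
qed


section \<open>Dyadic cubes and the shape of the conical annulus\<close>

declare side.simps [simp del] cube_set.simps [simp del] cube_center.simps [simp del]

lemma norm_le_sqrt_card:
  fixes x :: "real ^ 'n::finite"
  assumes "\<And>i. \<bar>x $ i\<bar> \<le> c"
  shows "norm x \<le> sqrt (real CARD('n)) * c"
proof -
  have "c \<ge> 0"
    using assms[of undefined] by linarith
  have "norm x \<le> L2_set (\<lambda>_::'n. c) UNIV"
    unfolding norm_vec_def using assms by (intro L2_set_mono) auto
  then show ?thesis
    using \<open>c \<ge> 0\<close> by (simp add: L2_set_def real_sqrt_mult)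
qed

definition cube_index :: "nat \<Rightarrow> real ^ 'n::finite \<Rightarrow> int ^ 'n" where
  "cube_index k x = (\<chi> i. \<lfloor>x $ i * 2 ^ k\<rfloor>)"

lemma powi_minus_nat: "(2::real) powi (- int k) = (1 / 2) ^ k"
  by (simp add: power_int_minus power_int_of_nat power_divide field_simps)

lemma side_nat: "side (int k, j) = (1 / 2) ^ k"
  by (simp add: side.simps powi_minus_nat)

lemma mem_cube_set_iff: "x \<in> cube_set (int k, j) \<longleftrightarrow> cube_index k x = j"
proof -
  have "of_int a * (1 / 2) ^ k \<le> t \<and> t < (of_int a + 1) * (1 / 2) ^ k \<longleftrightarrow> \<lfloor>t * 2 ^ k\<rfloor> = a"
    for a :: int and t :: real
    by (simp add: floor_eq_iff power_divide field_simps)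
  then show ?thesis
    by (simp add: cube_set.simps powi_minus_nat cube_index_def vec_eq_iff del: power_int_minus)
qed

lemma cube_index_coarser:
  assumes "cube_index l x = cube_index l y" "k \<le> l"
  shows "cube_index k x = cube_index k y"
proof -
  have "cube_index k z = (\<chi> i. cube_index l z $ i div 2 ^ (l - k))" for z :: "real ^ 'a"
  proof -
    have "t * 2 ^ k = (t * 2 ^ l) / real_of_int (2 ^ (l - k))" for t :: real
    proof -
      have "(2::real) ^ l = 2 ^ k * 2 ^ (l - k)"
        using assms(2) by (simp flip: power_add)
      then show ?thesis by simp
    qed
    then have "\<lfloor>t * 2 ^ k\<rfloor> = \<lfloor>t * 2 ^ l\<rfloor> div 2 ^ (l - k)" for t :: real
      using floor_divide_real_eq_div[of "2 ^ (l - k)" "t * 2 ^ l"] by simp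
    then show ?thesis by (simp add: cube_index_def)
  qed
  then show ?thesis using assms(1) by metis
qed

lemma dist_le_of_cube_index_eq:
  fixes x y :: "real ^ 'n::finite"
  assumes "cube_index k x = cube_index k y"
  shows "dist x y \<le> sqrt (real CARD('n)) * (1 / 2) ^ k"
  unfolding dist_norm
proof (rule norm_le_sqrt_card)
  fix i
  have "\<lfloor>x $ i * 2 ^ k\<rfloor> = \<lfloor>y $ i * 2 ^ k\<rfloor>"
    using assms by (simp add: cube_index_def vec_eq_iff)
  then have "\<bar>x $ i * 2 ^ k - y $ i * 2 ^ k\<bar> \<le> 1"
    by linarith
  then have "\<bar>x $ i - y $ i\<bar> * 2 ^ k \<le> 1"
    by (simp add: left_diff_distrib[symmetric] abs_mult)
  then show "\<bar>(x - y) $ i\<bar> \<le> (1 / 2) ^ k"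
    by (simp add: power_divide field_simps)
qed

lemma dist_cube_center:
  fixes x :: "real ^ 'n::finite"
  assumes "cube_index k x = j"
  shows "dist x (cube_center (int k, j)) \<le> sqrt (real CARD('n)) * (1 / 2) ^ k"
proof -
  have "cube_index k (cube_center (int k, j)) = j"
    by (simp add: cube_center.simps cube_index_def vec_eq_iff powi_minus_nat power_divide floor_eq_iff
        del: power_int_minus)
  then show ?thesis
    using assms by (intro dist_le_of_cube_index_eq) simp
qed

lemma borel_cube_set: "cube_set Q \<in> sets borel"
proof (cases Q)
  case (Pair k j)
  define a b where "a i = of_int (j $ i) * (2::real) powi (- k)"
    and "b i = (of_int (j $ i) + 1) * (2::real) powi (- k)" for i
  have "cube_set Q = (\<Inter>i. {x. a i \<le> x $ i} \<inter> {x. x $ i < b i})"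
    using Pair by (auto simp: cube_set.simps a_def b_def)
  moreover have "closed {x. a i \<le> x $ i}" "open {x. x $ i < b i}" for i :: 'a
    using closed_halfspace_component_ge_cart[of "a i" i] open_halfspace_component_lt_cart[of i "b i"]
    by auto
  ultimately show ?thesis
    by (auto intro!: sets.countable_INT'' sets.Int borel_closed borel_open)
qed

lemma finite_cube_index:
  fixes E :: "(real ^ 'n::finite) set"
  assumes "bounded E"
  shows "finite (cube_index k ` E)"
proof -
  obtain N where N: "\<And>x. x \<in> E \<Longrightarrow> norm x \<le> N"
    using assms by (auto simp: bounded_iff)
  define c where "c = \<lceil>N * 2 ^ k\<rceil> + 1"
  have "cube_index k ` E \<subseteq> vec_lambda ` (UNIV \<rightarrow>\<^sub>E {-c..c})"
  proof clarify
    fix x assume "x \<in> E"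
    have "cube_index k x $ i \<in> {-c..c}" for i
    proof -
      have "\<bar>x $ i\<bar> \<le> N"
        using component_le_norm_cart[of x i] N[OF \<open>x \<in> E\<close>] by linarith
      then have "\<bar>x $ i * 2 ^ k\<bar> \<le> N * 2 ^ k"
        by (simp add: abs_mult)
      then show ?thesis
        unfolding c_def cube_index_def by simp linarith
    qed
    then show "cube_index k x \<in> vec_lambda ` (UNIV \<rightarrow>\<^sub>E {-c..c})"
      by (intro image_eqI[of _ _ "vec_nth (cube_index k x)"]) auto
  qed
  moreover have "finite (vec_lambda ` (UNIV \<rightarrow>\<^sub>E {-c..c}) :: (int ^ 'n) set)"
    by (intro finite_imageI finite_PiE) auto
  ultimately show ?thesis by (rule finite_subset)
qed

lemma mem_bad_cone_over: "y \<in> bad_cone_over V \<alpha> Q \<longleftrightarrow> (\<exists>x\<in>Q. y - x \<in> bad_cone V \<alpha>)"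
  unfolding bad_cone_over_def
  by (auto simp: image_iff) (metis add_diff_cancel_left' diff_add_cancel add.commute)+

lemma bad_cone_scaleR:
  assumes "subspace V" "c > 0"
  shows "c *\<^sub>R x \<in> bad_cone V \<alpha> \<longleftrightarrow> x \<in> bad_cone V \<alpha>"
  using assms
  by (simp add: bad_cone_def infdist_subspace_scaleR subspace_orthogonal_comp mult.left_commute)

lemma cone_radius_nat:
  "cone_radius \<alpha> (int k, j :: int ^ 'n::finite)
     = 81 * sqrt (real CARD('n)) * max \<alpha> (1 / \<alpha>) * (1 / 2) ^ k"
  by (simp add: cone_radius_def side_nat)

definition rescale :: "nat \<Rightarrow> int ^ 'n::finite \<Rightarrow> real ^ 'n \<Rightarrow> real ^ 'n" where
  "rescale k j x = (1 / 2) ^ k *\<^sub>R (x + (\<chi> i. of_int (j $ i)))"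

lemma surj_rescale: "surj (rescale k j)"
proof (rule surjI)
  show "rescale k j (2 ^ k *\<^sub>R y - (\<chi> i. of_int (j $ i))) = y" for y
    by (simp add: rescale_def power_divide)
qed

lemma rescale_diff: "rescale k j x - rescale k j y = (1 / 2) ^ k *\<^sub>R (x - y)"
  by (simp add: rescale_def algebra_simps)

lemma cube_index_rescale: "cube_index k (rescale k j x) = j + cube_index 0 x"
  by (simp add: cube_index_def rescale_def vec_eq_iff power_divide)

lemma rescale_mem_conical_annulus:
  assumes V: "subspace V"
  shows "rescale k j y \<in> conical_annulus V \<alpha> (int k, j) \<longleftrightarrow> y \<in> conical_annulus V \<alpha> (int 0, 0)"
proof -
  let ?c = "(1 / 2) ^ k :: real" and ?r = "cone_radius \<alpha> (int 0, 0 :: int ^ 'a)"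
  have center: "cube_center (int k, j) = rescale k j (cube_center (int 0, 0))"
    by (simp add: cube_center.simps vec_eq_iff rescale_def powi_minus_nat algebra_simps
        del: power_int_minus)
  have dist: "dist (cube_center (int k, j)) (rescale k j y) = ?c * dist (cube_center (int 0, 0)) y"
    unfolding center dist_norm by (simp add: rescale_diff)
  have radius: "cone_radius \<alpha> (int k, j) = ?c * ?r"
    unfolding cone_radius_nat by simp
  have "rescale k j y \<in> bad_cone_over V \<alpha> (cube_set (int k, j)) \<longleftrightarrow>
      (\<exists>x. rescale k j x \<in> cube_set (int k, j) \<and> rescale k j y - rescale k j x \<in> bad_cone V \<alpha>)"
    unfolding mem_bad_cone_over using surj_rescale by (metis surjD)
  also have "\<dots> \<longleftrightarrow> y \<in> bad_cone_over V \<alpha> (cube_set (int 0, 0))"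
    unfolding mem_bad_cone_over mem_cube_set_iff Bex_def rescale_diff cube_index_rescale
    by (simp add: bad_cone_scaleR[OF V])
  finally have "rescale k j y \<in> bad_cone_over V \<alpha> (cube_set (int k, j)) \<longleftrightarrow>
    y \<in> bad_cone_over V \<alpha> (cube_set (int 0, 0))" .
  moreover have "?c * dist (cube_center (int 0, 0)) y \<le> ?c * ?r \<longleftrightarrow>
      dist (cube_center (int 0, 0)) y \<le> ?r"
    by (rule mult_le_cancel_left_pos) simp
  moreover have "?c * dist (cube_center (int 0, 0)) y < ?c * ?r / 3 \<longleftrightarrow>
      dist (cube_center (int 0, 0)) y < ?r / 3"
    using mult_less_cancel_left_pos[of ?c "dist (cube_center (int 0, 0)) y" "?r / 3"] by simp
  ultimately show ?thesis
    unfolding conical_annulus_def Diff_iff Int_iff mem_cball mem_ball dist radius by blast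
qed

text \<open>The dependence of the Dini function on the cone is purely combinatorial: the annulus of a
  cube is a rescaled copy of the annulus of the unit cube, so the cubes near \<open>(k, j)\<close> are the
  \<open>(k, j + t)\<close> with \<open>t\<close> in a finite set of integer vectors depending on the cone only.
  Uncountably many cones therefore give rise to only countably many Dini functions.\<close>

definition cone_shape :: "(real ^ 'n::finite) set \<Rightarrow> real \<Rightarrow> (int ^ 'n) set" where
  "cone_shape V \<alpha> = cube_index 0 ` conical_annulus V \<alpha> (int 0, 0)"

lemma finite_cone_shape: "finite (cone_shape V \<alpha>)"
  unfolding cone_shape_def conical_annulus_def
  by (intro finite_cube_index bounded_subset[OF bounded_cball]) auto

lemma cone_shape_iff:
  assumes "subspace V"
  shows "t \<in> cone_shape V \<alpha> \<longleftrightarrow> cube_set (int k, j + t) \<inter> conical_annulus V \<alpha> (int k, j) \<noteq> {}"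
proof -
  have "cube_set (int k, j + t) \<inter> conical_annulus V \<alpha> (int k, j) \<noteq> {} \<longleftrightarrow>
      (\<exists>x. rescale k j x \<in> cube_set (int k, j + t) \<and> rescale k j x \<in> conical_annulus V \<alpha> (int k, j))"
    using surj_rescale[of k j] by auto (metis surjD)
  then show ?thesis
    unfolding mem_cube_set_iff rescale_mem_conical_annulus[OF assms] cube_index_rescale
    by (auto simp: cone_shape_def)
qed

lemma nearby_cubes_eq:
  assumes "subspace V"
  shows "nearby_cubes V \<alpha> (int k, j) = (\<lambda>t. (int k, j + t)) ` cone_shape V \<alpha>"
proof -
  have "side R = side (int k, j) \<longleftrightarrow> fst R = int k" for R :: "'a dyadic_cube"
    using power_int_strict_increasing[of "- int k" "- fst R" "2::real"]
      power_int_strict_increasing[of "- fst R" "- int k" "2::real"]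
    by (cases R; cases "fst R" "int k" rule: linorder_cases) (auto simp: side.simps)
  then have "nearby_cubes V \<alpha> (int k, j) =
      {R. \<exists>t. R = (int k, j + t) \<and> cube_set R \<inter> conical_annulus V \<alpha> (int k, j) \<noteq> {}}"
    unfolding nearby_cubes_def
    by auto (metis add.commute diff_add_cancel)
  then show ?thesis
    using cone_shape_iff[OF assms, of _ \<alpha> k j] by auto
qed

definition shape_mass ::
    "((real ^ 'n::finite) set \<Rightarrow> ennreal) \<Rightarrow> (int ^ 'n) set \<Rightarrow> nat \<Rightarrow> int ^ 'n \<Rightarrow> ennreal" where
  "shape_mass \<mu> S k j = (\<Sum>t\<in>S. \<mu> (cube_set (int k, j + t)))"

definition shape_defect ::
    "((real ^ 'n::finite) set \<Rightarrow> ennreal) \<Rightarrow> (int ^ 'n) set \<Rightarrow> nat \<Rightarrow> int ^ 'n \<Rightarrow> ennreal" where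
  "shape_defect \<mu> S k j =
     (if \<mu> (cube_set (int k, j)) > 0 then shape_mass \<mu> S k j / \<mu> (cube_set (int k, j)) else 0)"

definition shape_dini ::
    "((real ^ 'n::finite) set \<Rightarrow> ennreal) \<Rightarrow> (int ^ 'n) set \<Rightarrow> real ^ 'n \<Rightarrow> ennreal" where
  "shape_dini \<mu> S x = (\<Sum>k. shape_defect \<mu> S k (cube_index k x))"

lemma defect_eq_shape_defect:
  assumes "subspace V"
  shows "defect \<mu> V \<alpha> (int k, j) = shape_defect \<mu> (cone_shape V \<alpha>) k j"
proof -
  have inj: "inj_on (\<lambda>t. (int k, j + t)) (cone_shape V \<alpha>)"
    by (simp add: inj_on_def)
  have "(\<Sum>\<^sub>\<infinity>R\<in>nearby_cubes V \<alpha> (int k, j). \<mu> (cube_set R) / c) = shape_mass \<mu> (cone_shape V \<alpha>) k j / c"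
    for c
    unfolding nearby_cubes_eq[OF assms] shape_mass_def
    by (simp add: finite_cone_shape sum.reindex[OF inj] sum_distrib_right divide_ennreal_def
       )
  then show ?thesis
    by (simp add: defect_def shape_defect_def)
qed

text \<open>A point lies in exactly one cube of each generation.\<close>

lemma conical_dini_eq_shape_dini:
  fixes V :: "(real ^ 'n::finite) set"
  assumes "subspace V"
  shows "conical_dini \<mu> V \<alpha> x = shape_dini \<mu> (cone_shape V \<alpha>) x"
proof -
  define q where "q k = (int k, cube_index k x)" for k
  have inj: "inj q"
    by (simp add: q_def inj_on_def)
  have side: "side (k, j) \<le> 1 \<longleftrightarrow> k \<ge> 0" for k and j :: "int ^ 'n"
  proof
    show "side (k, j) \<le> 1" if "k \<ge> 0"
      using that side_nat[of "nat k" j] by (simp add: power_le_one)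
    show "k \<ge> 0" if "side (k, j) \<le> 1"
    proof (rule ccontr)
      assume "\<not> k \<ge> 0"
      then have "(1::real) < 2 powi (- k)"
        by (intro one_less_power_int) auto
      with that show False by (simp add: side.simps)
    qed
  qed
  have "conical_dini \<mu> V \<alpha> x = (\<Sum>\<^sub>\<infinity>Q\<in>range q. defect \<mu> V \<alpha> Q)"
    unfolding conical_dini_def
  proof (rule infsum_cong_neutral)
    fix Q :: "'n dyadic_cube"
    obtain k j where Q: "Q = (k, j)" by (cases Q)
    show "defect \<mu> V \<alpha> Q * indicator (cube_set Q) x = 0" if "Q \<in> {Q. side Q \<le> 1} - range q"
    proof -
      have k: "k = int (nat k)"
        using that side[of k j] by (simp add: Q)
      then have "Q \<noteq> q (nat k)"
        using that by blast
      then have "x \<notin> cube_set Q"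
        using k mem_cube_set_iff[of x "nat k" j] by (auto simp: Q q_def)
      then show ?thesis by simp
    qed
    show "defect \<mu> V \<alpha> Q = 0" if "Q \<in> range q - {Q. side Q \<le> 1}"
      using that side by (auto simp: q_def)
    show "defect \<mu> V \<alpha> Q * indicator (cube_set Q) x = defect \<mu> V \<alpha> Q"
      if "Q \<in> {Q. side Q \<le> 1} \<inter> range q"
      using that by (auto simp: q_def mem_cube_set_iff)
  qed
  also have "\<dots> = (\<Sum>\<^sub>\<infinity>k. defect \<mu> V \<alpha> (q k))"
    by (simp add: infsum_reindex[OF inj] o_def)
  also have "\<dots> = (\<Sum>k. defect \<mu> V \<alpha> (q k))"
    by (intro sums_unique has_sum_imp_sums has_sum_infsum nonneg_summable_on_complete) simp
  finally show ?thesis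
    by (simp add: q_def defect_eq_shape_defect[OF assms] shape_dini_def)
qed


section \<open>Radon measures\<close>

locale radon =
  fixes \<mu> :: "(real ^ 'n::finite) set \<Rightarrow> ennreal"
  assumes radon_measure: "radon_measure \<mu>"
begin

lemma outer_measure_space: "outer_measure_space UNIV \<mu>"
  using radon_measure by (simp add: radon_measure_def)

lemma empty [simp]: "\<mu> {} = 0"
  using outer_measure_space by (simp add: outer_measure_space_def positive_def)

lemma mono: "A \<subseteq> B \<Longrightarrow> \<mu> A \<le> \<mu> B"
  using outer_measure_space by (simp add: outer_measure_space_def increasing_def)

lemma subadditive: "\<mu> (\<Union>i. A i) \<le> (\<Sum>i. \<mu> (A i))" for A :: "nat \<Rightarrow> _"
proof -
  have "\<mu> (\<Union>i. disjointed A i) \<le> (\<Sum>i. \<mu> (disjointed A i))"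
    using outer_measure_space disjoint_family_disjointed[of A]
    by (auto simp: outer_measure_space_def countably_subadditive_def)
  also have "\<dots> \<le> (\<Sum>i. \<mu> (A i))"
    by (intro suminf_le summableI mono disjointed_subset)
  finally show ?thesis
    by (simp add: UN_disjointed_eq)
qed

lemma finite_subadditive:
  assumes "finite I"
  shows "\<mu> (\<Union>i\<in>I. A i) \<le> (\<Sum>i\<in>I. \<mu> (A i))"
  using assms
proof (induction I)
  case (insert i I)
  have "\<mu> (A i \<union> (\<Union>i\<in>I. A i)) \<le> \<mu> (\<Union>k. binaryset (A i) (\<Union>i\<in>I. A i) k)"
    by (simp add: UN_binaryset_eq)
  also have "\<dots> \<le> (\<Sum>k. \<mu> (binaryset (A i) (\<Union>i\<in>I. A i) k))"
    by (rule subadditive)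
  also have "\<dots> = \<mu> (A i) + \<mu> (\<Union>i\<in>I. A i)"
    using suminf_binaryset_eq[of \<mu>] by simp
  also have "\<dots> \<le> \<mu> (A i) + (\<Sum>i\<in>I. \<mu> (A i))"
    using insert.IH by (rule add_left_mono)
  finally show ?case
    using insert.hyps by simp
qed simp

lemma Un_le: "\<mu> (A \<union> B) \<le> \<mu> A + \<mu> B"
  using finite_subadditive[of "UNIV :: bool set" "\<lambda>b. if b then A else B"]
  by (simp add: UNIV_bool Un_commute add.commute)

lemma Diff_positive:
  assumes "\<mu> B < \<mu> A"
  shows "\<mu> (A - B) > 0"
proof (rule ccontr)
  assume "\<not> \<mu> (A - B) > 0"
  moreover have "\<mu> A \<le> \<mu> (A - B) + \<mu> B"
    by (rule order_trans[OF mono Un_le]) auto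
  ultimately show False
    using assms by simp
qed

lemma null_UN:
  assumes "countable I" "\<And>i. i \<in> I \<Longrightarrow> \<mu> (A i) = 0"
  shows "\<mu> (\<Union>i\<in>I. A i) = 0"
proof (cases "I = {}")
  case False
  have "\<mu> (\<Union>i\<in>I. A i) = \<mu> (\<Union>n. A (from_nat_into I n))"
    using range_from_nat_into[OF False assms(1)] by (metis image_image)
  also have "\<dots> \<le> (\<Sum>n. \<mu> (A (from_nat_into I n)))"
    by (rule subadditive)
  also have "\<dots> = 0"
    using assms(2) from_nat_into[OF False] by simp
  finally show ?thesis by simp
qed simp

lemma positive_piece:
  assumes "countable I" "\<mu> E > 0" "E \<subseteq> (\<Union>i\<in>I. A i)"
  obtains i where "i \<in> I" "\<mu> (A i) > 0"
proof -
  have "\<exists>i\<in>I. \<mu> (A i) > 0"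
  proof (rule ccontr)
    assume "\<not> (\<exists>i\<in>I. \<mu> (A i) > 0)"
    then have "\<mu> (\<Union>i\<in>I. A i) = 0"
      by (intro null_UN[OF assms(1)]) (auto simp: zero_less_iff_neq_zero)
    with mono[OF assms(3)] assms(2) show False by simp
  qed
  then show thesis
    using that by blast
qed

lemma finite_bounded:
  assumes "bounded A"
  shows "\<mu> A < \<infinity>"
proof -
  have "\<mu> A \<le> \<mu> (closure A)"
    by (rule mono) (rule closure_subset)
  also have "\<dots> < \<infinity>"
    using radon_measure assms by (simp add: radon_measure_def compact_closure)
  finally show ?thesis .
qed

text \<open>Integration takes place on the Borel sets, while the sets \<open>E\<close> and \<open>\<Gamma>\<close> of the theorem are
  measured by the outer measure.\<close>

definition borel_part :: "(real ^ 'n) measure" where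
  "borel_part = measure_of UNIV (sets borel) \<mu>"

lemma space_borel_part [simp]: "space borel_part = UNIV"
  by (simp add: borel_part_def)

lemma sets_borel_part [simp, measurable_cong]: "sets borel_part = sets borel"
  using sets.sigma_sets_eq[of "borel :: (real ^ 'n) measure"] by (simp add: borel_part_def)

lemma emeasure_borel_part:
  assumes "A \<in> sets borel"
  shows "emeasure borel_part A = \<mu> A"
proof (rule emeasure_measure_of[OF borel_part_def])
  have "measure_space UNIV (lambda_system UNIV UNIV \<mu>) \<mu>"
    using sigma_algebra.caratheodory_lemma[OF sigma_algebra_Pow, of UNIV \<mu>] outer_measure_space
    by simp
  then have "countably_additive (lambda_system UNIV UNIV \<mu>) \<mu>"
    by (simp add: measure_space_def)
  then show "countably_additive (sets borel_part) \<mu>"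
    using radon_measure sets.top unfolding countably_additive_def radon_measure_def sets_borel_part
    by (meson subset_iff subset_trans)
  show "positive (sets borel_part) \<mu>"
    by (simp add: positive_def)
qed (use assms in auto)

lemma emeasure_cube_set [simp]: "emeasure borel_part (cube_set Q) = \<mu> (cube_set Q)"
  by (simp add: emeasure_borel_part borel_cube_set)

lemma finite_cube_set: "\<mu> (cube_set (int k, j)) < \<infinity>"
proof (rule finite_bounded)
  have "cube_set (int k, j) \<subseteq> cball (cube_center (int k, j)) (sqrt (real CARD('n)) * (1 / 2) ^ k)"
    using dist_cube_center by (auto simp: mem_cube_set_iff dist_commute)
  then show "bounded (cube_set (int k, j))"
    by (rule bounded_subset[OF bounded_cball])
qed


section \<open>Integrating the Dini function along a set\<close>

text \<open>The Dini series restricted to the cubes that meet \<open>E\<close>.  It loses nothing on \<open>E\<close>, and it is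
  a series of step functions on cubes, so that it can be integrated over the whole space even if
  \<open>E\<close> is not measurable.\<close>

definition dini_along :: "(int ^ 'n) set \<Rightarrow> (real ^ 'n) set \<Rightarrow> real ^ 'n \<Rightarrow> ennreal" where
  "dini_along S E x =
     (\<Sum>k. if cube_index k x \<in> cube_index k ` E then shape_defect \<mu> S k (cube_index k x) else 0)"

lemma dini_along_eq: "x \<in> E \<Longrightarrow> dini_along S E x = shape_dini \<mu> S x"
  by (simp add: dini_along_def shape_dini_def)

lemma dini_along_term:
  assumes "bounded E"
  shows "(if cube_index k x \<in> cube_index k ` E then shape_defect \<mu> S k (cube_index k x) else 0) =
    (\<Sum>j\<in>cube_index k ` E. shape_defect \<mu> S k j * indicator (cube_set (int k, j)) x)"
proof -
  have "(\<Sum>j\<in>cube_index k ` E. shape_defect \<mu> S k j * indicator (cube_set (int k, j)) x) =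
      (\<Sum>j\<in>cube_index k ` E. if cube_index k x = j then shape_defect \<mu> S k j else 0)"
    by (intro sum.cong) (auto simp: indicator_def mem_cube_set_iff)
  then show ?thesis
    using finite_cube_index[OF assms, of k] by (simp add: sum.delta')
qed

lemma borel_measurable_dini_along [measurable]:
  assumes "bounded E"
  shows "dini_along S E \<in> borel_measurable borel_part"
  unfolding dini_along_def[abs_def] dini_along_term[OF assms]
  using borel_cube_set by measurable

lemma integral_dini_along:
  assumes "bounded E"
  shows "(\<integral>\<^sup>+x. dini_along S E x \<partial>borel_part) =
    (\<Sum>k. \<Sum>j\<in>cube_index k ` E. shape_defect \<mu> S k j * \<mu> (cube_set (int k, j)))"
proof -
  have [measurable]: "cube_set Q \<in> sets borel" for Q :: "'n dyadic_cube"
    by (rule borel_cube_set)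
  show ?thesis
    unfolding dini_along_def dini_along_term[OF assms]
    by (simp add: nn_integral_suminf nn_integral_sum nn_integral_cmult_indicator)
qed

text \<open>The integral of a defect over its own cube cancels the denominator.  Over a null cube the
  integral is \<open>0\<close>, whatever the mass nearby, and only the inequality survives.\<close>

lemma shape_defect_times_mass:
  assumes "\<mu> (cube_set (int k, j)) > 0"
  shows "shape_defect \<mu> S k j * \<mu> (cube_set (int k, j)) = shape_mass \<mu> S k j"
  using assms finite_cube_set[of k j]
  by (simp add: shape_defect_def ennreal_divide_times ennreal_mult_divide_eq mult_divide_eq_ennreal)

lemma shape_defect_times_mass_le:
  "shape_defect \<mu> S k j * \<mu> (cube_set (int k, j)) \<le> shape_mass \<mu> S k j"
  using shape_defect_times_mass[of k j S]
  by (cases "\<mu> (cube_set (int k, j)) = 0") (auto simp: zero_less_iff_neq_zero)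

end


section \<open>Finite Dini function implies a charged Lipschitz graph\<close>

lemma suminf_tail_less:
  fixes f :: "nat \<Rightarrow> ennreal"
  assumes "(\<Sum>k. f k) < \<infinity>" "\<epsilon> > 0"
  obtains K where "(\<Sum>k. f (k + K)) < \<epsilon>"
proof -
  have split: "(\<Sum>k. f k) = (\<Sum>k. f (k + K)) + (\<Sum>k<K. f k)" for K
    by (rule suminf_offset) (rule summableI)
  have tail: "(\<Sum>k. f (k + K)) = (\<Sum>k. f k) - (\<Sum>k<K. f k)" for K
  proof -
    have "(\<Sum>k<K. f k) < \<infinity>"
      by (rule le_less_trans[OF sum_le_suminf[OF summableI] assms(1)]) auto
    then have "(\<Sum>k. f (k + K)) + (\<Sum>k<K. f k) - (\<Sum>k<K. f k) = (\<Sum>k. f (k + K))"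
      unfolding infinity_ennreal_def by (rule ennreal_add_diff_cancel_right[OF less_imp_neq])
    then show ?thesis
      by (simp only: split[of K, symmetric])
  qed
  have "(\<lambda>K. (\<Sum>k. f k) - (\<Sum>k<K. f k)) \<longlonglongrightarrow> (\<Sum>k. f k) - (\<Sum>k. f k)"
    using assms(1) by (intro tendsto_diff_ennreal tendsto_const summable_LIMSEQ summableI) auto
  then have "(\<lambda>K. \<Sum>k. f (k + K)) \<longlonglongrightarrow> 0"
    using assms(1) by (simp add: tail)
  then have "\<forall>\<^sub>F K in sequentially. (\<Sum>k. f (k + K)) < \<epsilon>"
    using assms(2) by (rule order_tendstoD)
  then show thesis
    using that by (auto simp: eventually_sequentially)
qed

lemma dyadic_scale:
  fixes c d :: real
  assumes "0 < d" "d < c * (1 / 2) ^ K"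
  obtains k where "K \<le> k" "c * (1 / 2) ^ k / 2 \<le> d" "d < c * (1 / 2) ^ k"
proof -
  have c: "c > 0"
  proof (rule ccontr)
    assume "\<not> c > 0"
    then have "c * (1 / 2) ^ K \<le> 0"
      by (intro mult_nonpos_nonneg) auto
    with assms show False by simp
  qed
  obtain n where "(1 / 2) ^ n < d / c"
    using real_arch_pow_inv[of "d / c" "1 / 2"] assms(1) c by auto
  then have "c * (1 / 2) ^ n \<le> d"
    using c by (simp add: pos_less_divide_eq mult.commute)
  then have ex: "\<exists>n. c * (1 / 2) ^ n \<le> d" ..
  define l where "l = (LEAST n. c * (1 / 2) ^ n \<le> d)"
  have l: "c * (1 / 2) ^ l \<le> d"
    unfolding l_def using ex by (rule LeastI_ex)
  have "K < l"
  proof (rule ccontr)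
    assume "\<not> K < l"
    then have "c * (1 / 2) ^ K \<le> c * (1 / 2) ^ l"
      using c by (intro mult_left_mono power_decreasing) auto
    with l assms(2) show False by simp
  qed
  then obtain k where k: "l = Suc k"
    by (cases l) auto
  have "\<not> c * (1 / 2) ^ k \<le> d"
    using not_less_Least[of k "\<lambda>n. c * (1 / 2) ^ n \<le> d"] k by (simp add: l_def)
  then show thesis
    using that[of k] \<open>K < l\<close> l k by simp
qed

text \<open>The annulus has aspect ratio \<open>3\<close>, more than the ratio \<open>2\<close> of consecutive scales, and its
  radii dwarf the diameter of the cube: a point of the bad cone at \<open>x\<close> lies in the annulus of
  one of the cubes containing \<open>x\<close>.\<close>

lemma bad_cone_mem_conical_annulus:
  fixes x y :: "real ^ 'n::finite"
  assumes V: "subspace V" and "\<alpha> > 0" and bad: "y - x \<in> bad_cone V \<alpha>"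
    and eq: "cube_index K x = cube_index K y"
  obtains k where "K \<le> k" "y \<in> conical_annulus V \<alpha> (int k, cube_index k x)"
proof -
  define s where "s = sqrt (real CARD('n))"
  define M where "M = max \<alpha> (1 / \<alpha>)"
  have s: "s > 0"
    by (simp add: s_def)
  have M: "M \<ge> 1"
    using \<open>\<alpha> > 0\<close> by (cases "\<alpha> \<ge> 1") (auto simp: M_def le_max_iff_disj)
  have "x \<noteq> y"
    using bad subspace_0[OF V] subspace_0[OF subspace_orthogonal_comp, of V]
    by (auto simp: bad_cone_def)
  moreover have "dist x y < 324 / 5 * s * M * (1 / 2) ^ K"
  proof -
    have "dist x y \<le> s * (1 / 2) ^ K"
      using dist_le_of_cube_index_eq[OF eq] by (simp add: s_def)
    also have "\<dots> = 1 * (s * 1 * (1 / 2) ^ K)" by simp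
    also have "\<dots> < 324 / 5 * (s * 1 * (1 / 2) ^ K)"
      using s by (intro mult_strict_right_mono) auto
    also have "\<dots> \<le> 324 / 5 * (s * M * (1 / 2) ^ K)"
      using s M by (intro mult_left_mono mult_right_mono) auto
    finally show ?thesis by simp
  qed
  \<comment> \<open>The constant is \<open>4/5\<close> of the radius, which leaves room on both sides of the annulus for the
    distance between \<open>x\<close> and the centre of its cube.\<close>
  ultimately obtain k where k: "K \<le> k" "324 / 5 * s * M * (1 / 2) ^ k / 2 \<le> dist x y"
      "dist x y < 324 / 5 * s * M * (1 / 2) ^ k"
    using dyadic_scale[of "dist x y" "324 / 5 * s * M" K] by auto
  let ?Q = "(int k, cube_index k x)" and ?c = "s * (1 / 2) ^ k"
  have center: "dist x (cube_center ?Q) \<le> ?c"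
    unfolding s_def by (rule dist_cube_center) simp
  have c: "?c \<le> M * ?c"
    using mult_right_mono[OF M, of ?c] s by simp
  have r: "cone_radius \<alpha> ?Q = 81 * (M * ?c)"
    by (simp add: cone_radius_nat s_def M_def)
  have "dist (cube_center ?Q) y \<le> 324 / 5 * (M * ?c) + ?c"
    using dist_triangle[of "cube_center ?Q" y x] center k(3) by (simp add: dist_commute mult_ac)
  moreover have "162 / 5 * (M * ?c) - ?c \<le> dist (cube_center ?Q) y"
    using dist_triangle[of x y "cube_center ?Q"] center k(2) by (simp add: dist_commute mult_ac)
  moreover have "y \<in> bad_cone_over V \<alpha> (cube_set ?Q)"
    using bad mem_cube_set_iff mem_bad_cone_over by metis
  ultimately have "y \<in> conical_annulus V \<alpha> ?Q"
    using c unfolding conical_annulus_def r by simp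
  then show thesis
    using that k(1) by blast
qed

context radon
begin

text \<open>The cubes through a point that meet \<open>E\<close> are those up to some generation, possibly all.  Up to
  any of these generations, the point is in the same cubes as a point of \<open>E\<close>.\<close>

lemma dini_along_le:
  assumes "\<And>x. x \<in> E \<Longrightarrow> shape_dini \<mu> S x \<le> N"
  shows "dini_along S E x \<le> N"
proof -
  let ?f = "\<lambda>k. if cube_index k x \<in> cube_index k ` E then shape_defect \<mu> S k (cube_index k x) else 0"
  have "(\<Sum>k<n. ?f k) \<le> N" for n
  proof (induction n)
    case (Suc n)
    show ?case
    proof (cases "cube_index n x \<in> cube_index n ` E")
      case True
      then obtain y where y: "y \<in> E" "cube_index n x = cube_index n y" by auto
      have "(\<Sum>k<Suc n. ?f k) \<le> (\<Sum>k<Suc n. shape_defect \<mu> S k (cube_index k y))"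
        using cube_index_coarser[OF y(2)] by (intro sum_mono) auto
      also have "\<dots> \<le> shape_dini \<mu> S y"
        unfolding shape_dini_def by (intro sum_le_suminf summableI) auto
      finally show ?thesis
        using assms[OF y(1)] by simp
    next
      case False
      then show ?thesis using Suc.IH by simp
    qed
  qed simp
  then show ?thesis
    unfolding dini_along_def by (intro suminf_le_const summableI)
qed

text \<open>Let \<open>F\<close> be a bounded part of \<open>E\<close>, still of positive measure, on which the Dini function is
  bounded.  The masses of all cubes that are near some cube meeting \<open>F\<close> form a convergent
  series, so that from some generation \<open>K\<close> on these nearby cubes cannot cover \<open>F\<close>.  Away from them,
  no two points of \<open>F\<close> in a common cube of generation \<open>K\<close> see each other in the bad cone.\<close>

lemma charged_lipschitz_graph:
  assumes V: "V \<in> grassmannian m" and \<alpha>: "\<alpha> > 0"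
    and E: "\<mu> E > 0" and fin: "\<And>x. x \<in> E \<Longrightarrow> shape_dini \<mu> (cone_shape V \<alpha>) x < \<infinity>"
  shows "\<exists>\<Gamma>. lipschitz_graph m \<Gamma> \<and> \<mu> \<Gamma> > 0"
proof -
  let ?S = "cone_shape V \<alpha>"
  have sub: "subspace V"
    using V by (simp add: grassmannian_def)
  \<comment> \<open>The defect of a null cube is \<open>0\<close> by convention and says nothing about the cubes nearby, so the
    null cubes have to be discarded.\<close>
  define Z where "Z = (\<Union>Q\<in>{Q :: 'n dyadic_cube. \<mu> (cube_set Q) = 0}. cube_set Q)"
  have "\<mu> Z = 0"
    unfolding Z_def by (rule null_UN) (auto intro: countableI_type)
  then have "\<mu> (E - Z) > 0"
    using E by (simp add: Diff_positive)
  moreover have "E - Z \<subseteq> (\<Union>N::nat. {x \<in> E - Z. shape_dini \<mu> ?S x \<le> of_nat N \<and> norm x \<le> N})"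
  proof
    fix x assume x: "x \<in> E - Z"
    obtain n where "shape_dini \<mu> ?S x < of_nat n"
      using ennreal_Ex_less_of_nat fin x by auto
    moreover obtain n' :: nat where "norm x \<le> n'"
      using real_arch_simple by blast
    ultimately have "shape_dini \<mu> ?S x \<le> of_nat (max n n')" "norm x \<le> max n n'"
      by (auto intro: order_trans[OF less_imp_le])
    then show "x \<in> (\<Union>N::nat. {x \<in> E - Z. shape_dini \<mu> ?S x \<le> of_nat N \<and> norm x \<le> N})"
      using x by blast
  qed
  ultimately obtain N :: nat where
      N: "\<mu> {x \<in> E - Z. shape_dini \<mu> ?S x \<le> of_nat N \<and> norm x \<le> N} > 0"
    by (rule positive_piece[OF countableI_type]) (rule that)
  define F where "F = {x \<in> E - Z. shape_dini \<mu> ?S x \<le> of_nat N \<and> norm x \<le> N}"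
  have F: "\<mu> F > 0" "\<And>x. x \<in> F \<Longrightarrow> shape_dini \<mu> ?S x \<le> of_nat N" "\<And>x. x \<in> F \<Longrightarrow> norm x \<le> N"
    using N by (auto simp: F_def)
  have pos: "\<mu> (cube_set (int k, j)) > 0" if j: "j \<in> cube_index k ` F" for k j
  proof -
    obtain x where x: "j = cube_index k x" "x \<in> F"
      using j by (rule imageE)
    have "x \<notin> Z"
      using x(2) unfolding F_def by blast
    moreover have "x \<in> cube_set (int k, j)"
      by (simp add: mem_cube_set_iff x(1))
    ultimately have "\<mu> (cube_set (int k, j)) \<noteq> 0"
      unfolding Z_def by blast
    then show ?thesis
      by (simp add: zero_less_iff_neq_zero)
  qed
  have "bounded F"
    using F(3) by (auto simp: bounded_iff)
  let ?R = "real N + sqrt (real CARD('n))"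
  have "dini_along ?S F x \<le> of_nat N * indicator (cball 0 ?R) x" for x
  proof (cases "x \<in> cball 0 ?R")
    case True
    then show ?thesis using dini_along_le[OF F(2)] by simp
  next
    case False
    have "cube_index k x \<notin> cube_index k ` F" for k
    proof
      assume "cube_index k x \<in> cube_index k ` F"
      then obtain y where "y \<in> F" "cube_index k x = cube_index k y" by auto
      then have y: "y \<in> F" "cube_index 0 x = cube_index 0 y"
        by (auto intro: cube_index_coarser)
      have "norm x \<le> norm y + dist x y"
        unfolding dist_norm using norm_triangle_ineq[of y "x - y"] by simp
      also have "\<dots> \<le> ?R"
        using dist_le_of_cube_index_eq[OF y(2)] F(3)[OF y(1)] by simp
      finally show False using False by simp
    qed
    then show ?thesis by (simp add: dini_along_def)
  qed
  then have "(\<integral>\<^sup>+x. dini_along ?S F x \<partial>borel_part) \<le>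
      (\<integral>\<^sup>+x. of_nat N * indicator (cball 0 ?R) x \<partial>borel_part)"
    by (intro nn_integral_mono)
  also have "\<dots> = of_nat N * \<mu> (cball 0 ?R)"
    by (simp add: nn_integral_cmult_indicator emeasure_borel_part)
  also have "\<dots> < \<infinity>"
    using finite_bounded[OF bounded_cball, of 0 ?R] by (simp add: ennreal_mult_less_top of_nat_less_top)
  finally have "(\<Sum>k. \<Sum>j\<in>cube_index k ` F. shape_mass \<mu> ?S k j) < \<infinity>"
    unfolding integral_dini_along[OF \<open>bounded F\<close>]
    by (simp add: shape_defect_times_mass pos cong: sum.cong)
  then obtain K where K: "(\<Sum>k. \<Sum>j\<in>cube_index (k + K) ` F. shape_mass \<mu> ?S (k + K) j) < \<mu> F"
    using suminf_tail_less[OF _ F(1)] by blast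
  define B where "B = (\<Union>k. \<Union>j\<in>cube_index (k + K) ` F. \<Union>t\<in>?S. cube_set (int (k + K), j + t))"
  have "\<mu> B \<le> (\<Sum>k. \<mu> (\<Union>j\<in>cube_index (k + K) ` F. \<Union>t\<in>?S. cube_set (int (k + K), j + t)))"
    unfolding B_def by (rule subadditive)
  also have "\<dots> \<le> (\<Sum>k. \<Sum>j\<in>cube_index (k + K) ` F. shape_mass \<mu> ?S (k + K) j)"
    unfolding shape_mass_def
    by (intro suminf_le summableI order_trans[OF finite_subadditive] sum_mono finite_subadditive
        finite_cube_index[OF \<open>bounded F\<close>] finite_cone_shape)
  finally have "\<mu> B < \<mu> F"
    using K by simp
  then have "\<mu> (F - B) > 0"
    by (rule Diff_positive)
  moreover have "F - B \<subseteq> (\<Union>j. (F - B) \<inter> cube_set (int K, j))"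
    by (auto simp: mem_cube_set_iff)
  ultimately obtain j where "\<mu> ((F - B) \<inter> cube_set (int K, j)) > 0"
    by (rule positive_piece[OF countableI_type])
  moreover define A where "A = (F - B) \<inter> cube_set (int K, j)"
  ultimately have "\<mu> A > 0" by simp
  have "cone_condition V \<alpha> A"
    unfolding cone_condition_def
  proof (intro ballI notI)
    fix x y assume xy: "x \<in> A" "y \<in> A" and "y - x \<in> bad_cone V \<alpha>"
    moreover have "cube_index K x = cube_index K y"
      using xy by (auto simp: A_def mem_cube_set_iff)
    ultimately obtain k where k: "K \<le> k" "y \<in> conical_annulus V \<alpha> (int k, cube_index k x)"
      using bad_cone_mem_conical_annulus[OF sub \<alpha>] by blast
    let ?t = "cube_index k y - cube_index k x"
    have "?t \<in> ?S"
      using k(2) mem_cube_set_iff[of y k "cube_index k x + ?t"]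
      by (auto simp: cone_shape_iff[OF sub, of _ _ k "cube_index k x"])
    moreover have "y \<in> cube_set (int k, cube_index k x + ?t)"
      by (simp add: mem_cube_set_iff)
    moreover have "x \<in> F"
      using xy by (simp add: A_def)
    ultimately have "y \<in> B"
      unfolding B_def using k(1) le_add_diff_inverse2[OF k(1)]
      by (intro UN_I[of "k - K"] UN_I[of "cube_index k x"] UN_I[of ?t]) auto
    then show False
      using xy by (simp add: A_def)
  qed
  moreover have "A \<noteq> {}"
    using \<open>\<mu> A > 0\<close> by auto
  ultimately obtain \<Gamma> where "lipschitz_graph m \<Gamma>" "A \<subseteq> \<Gamma>"
    using cone_condition_subset_lipschitz_graph[OF V] \<alpha> by (metis less_imp_le)
  then show ?thesis
    using \<open>\<mu> A > 0\<close> mono[of A \<Gamma>] by (auto intro: less_le_trans)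
qed

end


section \<open>A charged Lipschitz graph implies finite Dini function\<close>

text \<open>The opening of the cone exceeds the Lipschitz constant of the graph by a factor of at
  least \<open>2\<close>.  Since the annulus is far from its cube, points of the cone in it are
  so far from the graph that moving by the diameter of two cubes cannot bring them back.\<close>

lemma nearby_cube_dist_graph:
  fixes \<Gamma> :: "(real ^ 'n::finite) set"
  assumes V: "subspace V" and L: "L \<ge> 0" "cone_condition V L \<Gamma>"
    and \<alpha>: "\<alpha> = max 1 (2 * L)"
    and x: "x \<in> \<Gamma>" and t: "t \<in> cone_shape V \<alpha>" and y: "cube_index k y = cube_index k x + t"
  shows "3 * sqrt (real CARD('n)) / (1 + L) * (1 / 2) ^ k \<le> infdist y \<Gamma>"
    and "dist y x \<le> 83 * sqrt (real CARD('n)) * \<alpha> * (1 / 2) ^ k"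
proof -
  define s where "s = sqrt (real CARD('n)) * (1 / 2) ^ k"
  let ?D = "\<lambda>u. infdist u V" and ?D' = "\<lambda>u. infdist u (orthogonal_comp V)"
  let ?Q = "(int k, cube_index k x)"
  have s: "s > 0"
    by (simp add: s_def)
  have \<alpha>1: "\<alpha> \<ge> 1" "2 * L \<le> \<alpha>"
    by (auto simp: \<alpha>)
  have V': "subspace (orthogonal_comp V)"
    by (rule subspace_orthogonal_comp)
  obtain z where z: "z \<in> cube_set (int k, cube_index k x + t)" "z \<in> conical_annulus V \<alpha> ?Q"
    using t cone_shape_iff[OF V, of t \<alpha> k "cube_index k x"] by blast
  obtain x' where x': "x' \<in> cube_set ?Q" "z - x' \<in> bad_cone V \<alpha>"
    using z(2) by (auto simp: conical_annulus_def mem_bad_cone_over)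
  have "1 / \<alpha> \<le> \<alpha>"
    using \<alpha>1 by (auto simp: divide_le_eq intro: order_trans[OF \<alpha>1(1)])
  then have r: "cone_radius \<alpha> ?Q = 81 * (\<alpha> * s)"
    by (simp add: cone_radius_nat s_def max_def)
  have z_dist: "dist (cube_center ?Q) z \<le> 81 * (\<alpha> * s)" "27 * (\<alpha> * s) \<le> dist (cube_center ?Q) z"
    using z(2) unfolding conical_annulus_def r by auto
  have close: "dist y z \<le> s" "dist x x' \<le> s" "dist x' (cube_center ?Q) \<le> s" "dist x (cube_center ?Q) \<le> s"
    unfolding s_def using z(1) x'(1) y
    by (auto simp: mem_cube_set_iff intro: dist_le_of_cube_index_eq dist_cube_center)
  have s_le: "s \<le> \<alpha> * s"
    using mult_right_mono[OF \<alpha>1(1), of s] s by simp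
  have "dist y x \<le> dist y z + dist (cube_center ?Q) z + dist x (cube_center ?Q)"
    using dist_triangle[of y x z] dist_triangle[of z x "cube_center ?Q"] by (simp add: dist_commute)
  also have "\<dots> \<le> 83 * (\<alpha> * s)"
    using close z_dist(1) s_le by linarith
  finally show "dist y x \<le> 83 * sqrt (real CARD('n)) * \<alpha> * (1 / 2) ^ k"
    by (simp add: s_def mult_ac)
  have cone_z: "\<alpha> * ?D' (z - x') < ?D (z - x')"
    using x'(2) by (simp add: bad_cone_def)
  have "?D' (z - x') \<le> \<alpha> * ?D' (z - x')"
    using mult_right_mono[OF \<alpha>1(1), of "?D' (z - x')"] by (simp add: infdist_nonneg)
  moreover have "26 * (\<alpha> * s) \<le> dist z x'"
    using dist_triangle[of "cube_center ?Q" z x'] close(3) z_dist(2) s_le by (simp add: dist_commute)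
  moreover have "dist z x' \<le> ?D (z - x') + ?D' (z - x')"
    using norm_le_infdist_sum[OF V, of "z - x'"] by (simp add: dist_norm)
  ultimately have D_large: "13 * (\<alpha> * s) < ?D (z - x')"
    using cone_z by linarith
  have shift: "dist (y - x) (z - x') \<le> 2 * s"
    using dist_triangle_add[of y "- x" z "- x'"] close(1,2) by (simp add: dist_minus)
  have D_y: "?D (z - x') - 2 * s \<le> ?D (y - x)"
    using infdist_triangle[of "z - x'" V "y - x"] shift by (simp add: dist_commute)
  have D'_y: "?D' (y - x) \<le> ?D' (z - x') + 2 * s"
    using infdist_triangle[of "y - x" "orthogonal_comp V" "z - x'"] shift by simp
  have key: "3 * s \<le> (1 + L) * dist y x0" if x0: "x0 \<in> \<Gamma>" for x0
  proof -
    have graph: "?D (x0 - x) \<le> L * ?D' (x0 - x)"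
      using L(2) x x0 by (auto simp: cone_condition_def bad_cone_def not_less)
    have "?D' (x0 - x) \<le> ?D' (x0 - y) + ?D' (y - x)"
      using infdist_subspace_add_le[OF V', of "x0 - y" "y - x"] by simp
    moreover have "?D' (x0 - y) \<le> dist y x0"
      using infdist_subspace_le_norm[OF V', of "x0 - y"] by (simp add: dist_norm norm_minus_commute)
    ultimately have "?D' (x0 - x) \<le> dist y x0 + (?D' (z - x') + 2 * s)"
      using D'_y by linarith
    then have "L * ?D' (x0 - x) \<le> L * (dist y x0 + (?D' (z - x') + 2 * s))"
      using L(1) by (rule mult_left_mono)
    moreover have "?D (y - x) \<le> ?D (y - x0) + ?D (x0 - x)"
      using infdist_subspace_add_le[OF V, of "y - x0" "x0 - x"] by simp
    moreover have "?D (y - x0) \<le> dist y x0"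
      using infdist_subspace_le_norm[OF V, of "y - x0"] by (simp add: dist_norm)
    ultimately have "?D (z - x') - 2 * s \<le> (1 + L) * dist y x0 + L * ?D' (z - x') + 2 * (L * s)"
      using D_y graph by (simp add: algebra_simps)
    moreover have "2 * (L * ?D' (z - x')) \<le> ?D (z - x')"
      using mult_right_mono[OF \<alpha>1(2), of "?D' (z - x')"] cone_z by (simp add: infdist_nonneg)
    moreover have "2 * (L * s) \<le> \<alpha> * s"
      using mult_right_mono[OF \<alpha>1(2), of s] s by simp
    ultimately show ?thesis
      using D_large s_le s by linarith
  qed
  have "3 * s / (1 + L) \<le> dist y x0" if "x0 \<in> \<Gamma>" for x0
    using key[OF that] L(1) by (simp add: divide_le_eq mult.commute)
  then have "3 * s / (1 + L) \<le> infdist y \<Gamma>"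
    using x by (subst infdist_notempty) (auto intro!: cINF_greatest)
  then show "3 * sqrt (real CARD('n)) / (1 + L) * (1 / 2) ^ k \<le> infdist y \<Gamma>"
    by (simp add: s_def)
qed

text \<open>The distance \<open>d\<close> determines \<open>2 ^ k\<close> up to a factor \<open>C / c\<close>.  The number of possible \<open>k\<close> is
  written as a series, in which form it is integrated.\<close>

lemma bounded_overlap:
  fixes c C :: real
  assumes "c > 0"
  obtains p :: nat where
    "\<And>d. (\<Sum>k. indicator {k. c * (1 / 2) ^ k \<le> d \<and> d \<le> C * (1 / 2) ^ k} k) \<le> (of_nat p :: ennreal)"
proof -
  obtain p where p: "C / c < 2 ^ p"
    using real_arch_pow[of 2 "C / c"] by auto
  have "(\<Sum>k. indicator {k. c * (1 / 2) ^ k \<le> d \<and> d \<le> C * (1 / 2) ^ k} k) \<le> (of_nat p :: ennreal)" for d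
  proof -
    let ?A = "{k. c * (1 / 2) ^ k \<le> d \<and> d \<le> C * (1 / 2) ^ k}"
    define l where "l = (LEAST k. k \<in> ?A)"
    have sub: "?A \<subseteq> {l..<l + p}"
    proof
      fix k assume k: "k \<in> ?A"
      then have "l \<in> ?A"
        unfolding l_def by (rule LeastI)
      have "l \<le> k"
        unfolding l_def using k by (rule Least_le)
      have "c * (1 / 2) ^ l \<le> C * (1 / 2) ^ k"
        using k \<open>l \<in> ?A\<close> by auto
      then have "c * 2 ^ k \<le> C * 2 ^ l"
        by (simp add: power_divide field_simps)
      also have "\<dots> < (c * 2 ^ p) * 2 ^ l"
        using p assms by (simp add: pos_divide_less_eq mult.commute)
      finally have "(2::real) ^ k < 2 ^ (l + p)"
        using assms by (simp add: power_add mult_ac)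
      then have "k < l + p" by simp
      with \<open>l \<le> k\<close> show "k \<in> {l..<l + p}" by simp
    qed
    then have "(\<Sum>k. indicator ?A k :: ennreal) = (\<Sum>k\<in>{l..<l + p}. indicator ?A k)"
      by (intro suminf_finite) (auto simp: indicator_def)
    also have "\<dots> \<le> (\<Sum>k\<in>{l..<l + p}. 1)"
      by (intro sum_mono) (simp add: indicator_def)
    finally show ?thesis by simp
  qed
  then show thesis by (rule that)
qed

context radon
begin

text \<open>Let \<open>(k, j)\<close> range over the cubes of generation \<open>k\<close> that meet a bounded part of the graph.
  For fixed \<open>t\<close>, the cubes \<open>(k, j + t)\<close> are disjoint and lie in the set of points of a fixed ball
  whose distance to the graph is comparable to the side of the cubes.  These sets overlap boundedly,
  so the integral of the Dini function along the graph is at most a multiple of the mass of the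
  ball.\<close>

lemma finite_dini_on_lipschitz_graph:
  assumes "lipschitz_graph m \<Gamma>" "\<mu> \<Gamma> > 0"
  obtains V \<alpha> E where "V \<in> grassmannian m" "\<alpha> > 0" "\<mu> E > 0"
    "\<And>x. x \<in> E \<Longrightarrow> shape_dini \<mu> (cone_shape V \<alpha>) x < \<infinity>"
proof -
  obtain V L where V: "V \<in> grassmannian m" and L: "L \<ge> 0" "cone_condition V L \<Gamma>"
    using lipschitz_graph_cone_condition[OF assms(1)] by blast
  have sub: "subspace V"
    using V by (simp add: grassmannian_def)
  have "\<Gamma> \<subseteq> (\<Union>N::nat. \<Gamma> \<inter> cball 0 (real N))"
    using real_arch_simple by auto
  with assms(2) obtain N :: nat where "\<mu> (\<Gamma> \<inter> cball 0 (real N)) > 0"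
    by (rule positive_piece[OF countableI_type])
  moreover define F where "F = \<Gamma> \<inter> cball 0 (real N)"
  ultimately have F: "\<mu> F > 0" by simp
  have "bounded F"
    unfolding F_def by (rule bounded_subset[OF bounded_cball]) auto
  define \<alpha> where "\<alpha> = max 1 (2 * L)"
  have "\<alpha> > 0"
    by (simp add: \<alpha>_def)
  let ?S = "cone_shape V \<alpha>"
  define c where "c = 3 * sqrt (real CARD('n)) / (1 + L)"
  define C where "C = 83 * sqrt (real CARD('n)) * \<alpha>"
  have "c > 0" "C \<ge> 0"
    using L(1) \<open>\<alpha> > 0\<close> by (auto simp: c_def C_def)
  obtain p :: nat where p: "\<And>d. (\<Sum>k. indicator {k. c * (1 / 2) ^ k \<le> d \<and> d \<le> C * (1 / 2) ^ k} k)
      \<le> (of_nat p :: ennreal)"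
    using bounded_overlap[OF \<open>c > 0\<close>, of C] by blast
  let ?B = "cball 0 (real N + C) :: (real ^ 'n) set"
  define H where "H k = {y \<in> ?B. c * (1 / 2) ^ k \<le> infdist y \<Gamma> \<and> infdist y \<Gamma> \<le> C * (1 / 2) ^ k}" for k
  have H_borel: "H k \<in> sets borel" for k
  proof -
    have "H k = ?B \<inter> ({y. c * (1 / 2) ^ k \<le> infdist y \<Gamma>} \<inter> {y. infdist y \<Gamma> \<le> C * (1 / 2) ^ k})"
      by (auto simp: H_def)
    moreover have "closed \<dots>"
      by (intro closed_Int closed_cball closed_Collect_le continuous_intros)
    ultimately show ?thesis by (simp add: borel_closed)
  qed
  have near: "cube_set (int k, j + t) \<subseteq> H k" if j: "j \<in> cube_index k ` F" and t: "t \<in> ?S" for k j t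
  proof
    fix y assume "y \<in> cube_set (int k, j + t)"
    moreover obtain x where x: "x \<in> F" "j = cube_index k x"
      using j by auto
    ultimately have y: "cube_index k y = cube_index k x + t"
      by (simp add: mem_cube_set_iff)
    have "x \<in> \<Gamma>" "norm x \<le> real N"
      using x(1) by (auto simp: F_def)
    note dist = nearby_cube_dist_graph[OF sub L \<alpha>_def \<open>x \<in> \<Gamma>\<close> t y, folded c_def C_def]
    have "infdist y \<Gamma> \<le> C * (1 / 2) ^ k"
      using infdist_le[OF \<open>x \<in> \<Gamma>\<close>, of y] dist(2) by simp
    moreover have "dist y x \<le> C"
      using dist(2) mult_left_mono[OF power_le_one[of "1 / 2 :: real" k] \<open>C \<ge> 0\<close>] by simp
    then have "norm y \<le> real N + C"
      using norm_triangle_ineq[of x "y - x"] \<open>norm x \<le> real N\<close> by (simp add: dist_norm)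
    ultimately show "y \<in> H k"
      using dist(1) by (simp add: H_def)
  qed
  have mass: "(\<Sum>j\<in>cube_index k ` F. shape_mass \<mu> ?S k j) \<le> of_nat (card ?S) * \<mu> (H k)" for k
  proof -
    have "(\<Sum>j\<in>cube_index k ` F. \<mu> (cube_set (int k, j + t))) \<le> \<mu> (H k)" if t: "t \<in> ?S" for t
    proof -
      have "(\<Sum>j\<in>cube_index k ` F. emeasure borel_part (cube_set (int k, j + t))) =
          emeasure borel_part (\<Union>j\<in>cube_index k ` F. cube_set (int k, j + t))"
        using finite_cube_index[OF \<open>bounded F\<close>] borel_cube_set
        by (intro sum_emeasure) (auto simp: disjoint_family_on_def mem_cube_set_iff)
      also have "\<dots> \<le> emeasure borel_part (H k)"
        using near t H_borel by (intro emeasure_mono) auto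
      finally show ?thesis
        by (simp add: emeasure_borel_part H_borel)
    qed
    then have "(\<Sum>t\<in>?S. \<Sum>j\<in>cube_index k ` F. \<mu> (cube_set (int k, j + t))) \<le> (\<Sum>t\<in>?S. \<mu> (H k))"
      by (rule sum_mono)
    then show ?thesis
      unfolding shape_mass_def by (subst sum.swap) simp
  qed
  have "(\<Sum>k. \<mu> (H k)) = (\<integral>\<^sup>+y. (\<Sum>k. indicator (H k) y) \<partial>borel_part)"
    using H_borel by (simp add: nn_integral_suminf emeasure_borel_part)
  also have "\<dots> \<le> (\<integral>\<^sup>+y. of_nat p * indicator ?B y \<partial>borel_part)"
  proof (rule nn_integral_mono)
    fix y
    have "(\<Sum>k. indicator (H k) y :: ennreal) =
        (\<Sum>k. indicator {k. c * (1 / 2) ^ k \<le> infdist y \<Gamma> \<and> infdist y \<Gamma> \<le> C * (1 / 2) ^ k} k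
          * indicator ?B y)"
      by (intro arg_cong[of _ _ suminf] ext) (auto simp: H_def indicator_def)
    also have "\<dots> \<le> of_nat p * indicator ?B y"
      using p[of "infdist y \<Gamma>"] by (simp add: mult_right_mono)
    finally show "(\<Sum>k. indicator (H k) y :: ennreal) \<le> of_nat p * indicator ?B y" .
  qed
  also have "\<dots> = of_nat p * \<mu> ?B"
    by (simp add: nn_integral_cmult_indicator emeasure_borel_part)
  also have "\<dots> < \<infinity>"
    using finite_bounded[OF bounded_cball, of 0 "real N + C"]
    by (simp add: ennreal_mult_less_top of_nat_less_top)
  finally have H_finite: "(\<Sum>k. \<mu> (H k)) < \<infinity>" .
  have "(\<integral>\<^sup>+x. dini_along ?S F x \<partial>borel_part) =
      (\<Sum>k. \<Sum>j\<in>cube_index k ` F. shape_defect \<mu> ?S k j * \<mu> (cube_set (int k, j)))"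
    by (rule integral_dini_along[OF \<open>bounded F\<close>])
  also have "\<dots> \<le> (\<Sum>k. of_nat (card ?S) * \<mu> (H k))"
    by (intro suminf_le summableI order_trans[OF sum_mono mass] shape_defect_times_mass_le)
  also have "\<dots> < \<infinity>"
    using H_finite by (simp add: ennreal_mult_less_top of_nat_less_top)
  finally have "(\<integral>\<^sup>+x. dini_along ?S F x \<partial>borel_part) \<noteq> \<infinity>" by simp
  then have "emeasure borel_part (dini_along ?S F -` {\<infinity>} \<inter> space borel_part) = 0"
    using borel_measurable_dini_along[OF \<open>bounded F\<close>] by (intro nn_integral_PInf)
  moreover define Z where "Z = dini_along ?S F -` {\<infinity>}"
  moreover have "Z \<in> sets borel"
    using measurable_sets[OF borel_measurable_dini_along[OF \<open>bounded F\<close>], of "{\<infinity>}" ?S]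
    by (simp add: Z_def)
  ultimately have "\<mu> Z = 0"
    by (simp add: emeasure_borel_part)
  then have "\<mu> (F - Z) > 0"
    using F by (intro Diff_positive) simp
  moreover have "shape_dini \<mu> ?S x < \<infinity>" if "x \<in> F - Z" for x
    using that by (auto simp: Z_def dini_along_eq less_top)
  ultimately show thesis
    using that[OF V \<open>\<alpha> > 0\<close>] by blast
qed

end

section \<open>Charging Lipschitz graphs\<close>

theorem corollary1p7:
  fixes \<mu> :: "(real ^ 'n::finite) set \<Rightarrow> ennreal" and m :: nat
  assumes "1 \<le> m" and "m \<le> CARD('n) - 1"
    and "radon_measure \<mu>"
  shows "(\<exists>\<Gamma>. lipschitz_graph m \<Gamma> \<and> \<mu> \<Gamma> > 0) \<longleftrightarrow>
         (\<exists>E. \<mu> E > 0 \<and>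
            (\<forall>x\<in>E. \<exists>V\<in>grassmannian m. \<exists>\<alpha>>0. conical_dini \<mu> V \<alpha> x < \<infinity>))"
    (is "?graph \<longleftrightarrow> ?dini")
proof
  interpret radon \<mu>
    using assms(3) by unfold_locales
  have dini_eq: "conical_dini \<mu> V \<alpha> x = shape_dini \<mu> (cone_shape V \<alpha>) x" if "V \<in> grassmannian m"
    for V \<alpha> x
    using that by (intro conical_dini_eq_shape_dini) (simp add: grassmannian_def)
  show ?dini if ?graph
  proof -
    obtain \<Gamma> where "lipschitz_graph m \<Gamma>" "\<mu> \<Gamma> > 0"
      using \<open>?graph\<close> by blast
    then obtain V \<alpha> E where "V \<in> grassmannian m" "\<alpha> > 0" "\<mu> E > 0"
        "\<And>x. x \<in> E \<Longrightarrow> shape_dini \<mu> (cone_shape V \<alpha>) x < \<infinity>"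
      by (rule finite_dini_on_lipschitz_graph) blast
    then show ?thesis
      using dini_eq by (intro exI[of _ E]) auto
  qed
  show ?graph if ?dini
  proof -
    obtain E where E: "\<mu> E > 0"
        "\<forall>x\<in>E. \<exists>V\<in>grassmannian m. \<exists>\<alpha>>0. conical_dini \<mu> V \<alpha> x < \<infinity>"
      using \<open>?dini\<close> by blast
    define shapes :: "(int ^ 'n) set set"
      where "shapes = {cone_shape V \<alpha> |V \<alpha>. V \<in> grassmannian m \<and> \<alpha> > 0}"
    have "shapes \<subseteq> Collect finite"
      using finite_cone_shape by (auto simp: shapes_def)
    then have "countable shapes"
      by (rule countable_subset) (rule countable_Collect_finite)
    moreover have "E \<subseteq> (\<Union>S\<in>shapes. {x. shape_dini \<mu> S x < \<infinity>})"
    proof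
      fix x assume "x \<in> E"
      then obtain V \<alpha> where "V \<in> grassmannian m" "\<alpha> > 0" "conical_dini \<mu> V \<alpha> x < \<infinity>"
        using E(2) by blast
      then show "x \<in> (\<Union>S\<in>shapes. {x. shape_dini \<mu> S x < \<infinity>})"
        unfolding shapes_def using dini_eq by auto
    qed
    ultimately obtain S where "S \<in> shapes" "\<mu> {x. shape_dini \<mu> S x < \<infinity>} > 0"
      using positive_piece[OF _ E(1)] by blast
    then show ?thesis
      unfolding shapes_def using charged_lipschitz_graph by blast
  qed
qed

end
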